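(* Consider stripe solutions of the system $u_t = D\Delta u + L u + \check\alpha M u + \beta B(c) u_x + Q[u,u] + K[u,u,u]$ near a Turing instability, as in the context, with velocity parameter $c=c(\mu)$, for $|\mu|$ and amplitude sufficiently small. The sign of $c$, which is the direction of stripe motion relative to $\beta$, is determined by $\lambda_\beta$ as $\mathrm{sgn}(c)=-\mathrm{sgn}(\lambda_\beta)$, and in terms of the matrix $L$ it satisfies $$\mathrm{sgn}(c) = -\mathrm{sgn}(a_1).$$ That is, the motion is with $\beta$ if the first component is an inhibitor ($a_1<0$) and against $\beta$ otherwise.
   Context: **System.** $u_t = D\Delta u + L u + \check\alpha M u + \beta B u_x + Q[u,u] + K[u,u,u]$, $u(t,\cdot)\in\mathbb{R}^2$, space variable $(x,y)\in\mathbb{R}^2$. Here $D=\mathrm{diag}(d_1,d_2)$ with $d_1,d_2>0$, $L=\begin{pmatrix} a_1 & a_2 \\ a_3 & a_4 \end{pmatrix}$ and $M$ are real $2\times2$ matrices, $Q$ is a symmetric bilinear and $K$ a symmetric trilinear map on $\mathbb{R}^2$, $B=B(c)=\mathrm{diag}(1+c,c)$, $c\in\mathbb{R}$; $\check\alpha,\beta\in\mathbb{R}$ are parameters. **Turing instability (assumed at $\check\alpha=\beta=0$, with wavenumber $k_{\rm c}>0$).** With $\hat{\mathcal L}(k,\ell) = -(k^2+\ell^2)D+L+\check\alpha M+\mathrm{i}k\beta B$ and $d(\lambda,k,\ell)=\det(\hat{\mathcal L}(k,\ell)-\lambda\,\mathrm{Id})$, at $\check\alpha=\beta=0$: (1)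 all eigenvalues of $L$ have negative real part; (2) for $(k,\ell)\in\mathbb{R}^2$: $d(\lambda,k,\ell)=0$ and $\mathrm{Re}\,\lambda\ge0$ if and only if $\lambda=0$ and $k^2+\ell^2=k_{\rm c}^2$; (3) $\partial_\lambda d\ne0$ at $\lambda=0$, $k^2+\ell^2=k_{\rm c}^2$. These imply in particular $a_1+a_4<0$ and $a_2a_3<a_1a_4<0$. **Notation.** $\lambda_M:=-\partial_{\check\alpha}d/\partial_\lambda d$ at the Turing point is assumed non-zero, $\alpha=\lambda_M\check\alpha$, $\kappa=k_{\rm c}+\tilde\kappa$, $\mu=(\alpha,\beta,\tilde\kappa)$, and $$\lambda_\beta=\frac{a_4-k_{\rm c}^2d_2}{a_1+a_4-k_{\rm c}^2(d_1+d_2)}.$$ **Stripes.** Stripes are $y$-independent travelling waves, $2\pi/\kappa$-periodic in $x$, of small amplitude $A>0$, stationary in the frame with velocity $\beta c$, i.e. steady states of the system with $B=B(c)$. For small $\mu$ and $A$ their velocity parameter $c=c(\mu)$ is a small perturbation of $-\lambda_\beta$: $c=-\lambda_\beta+o(1)$ as $(\mu,A)\to0$. *)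

theory Defs
  imports "HOL-Analysis.Analysis"
begin

definition diag2 :: "real \<Rightarrow> real \<Rightarrow> real^2^2" where
  "diag2 p q = vector [vector [p, 0], vector [0, q]]"

definition B_mat :: "real \<Rightarrow> real^2^2" where
  "B_mat c = diag2 (1 + c) c"

definition complex_matrix :: "real^2^2 \<Rightarrow> complex^2^2" where
  "complex_matrix A = (\<chi> i j. complex_of_real (A $ i $ j))"

definition eigenvalue_of :: "real^2^2 \<Rightarrow> complex \<Rightarrow> bool" where
  "eigenvalue_of A z \<longleftrightarrow>
     (\<exists>v. v \<noteq> 0 \<and> complex_matrix A *v v = z *s v)"

definition symmetric_bilinear :: "(real^2 \<Rightarrow> real^2 \<Rightarrow> real^2) \<Rightarrow> bool" where
  "symmetric_bilinear Q \<longleftrightarrow> bilinear Q \<and> (\<forall>u v. Q u v = Q v u)"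

definition symmetric_trilinear :: "(real^2 \<Rightarrow> real^2 \<Rightarrow> real^2 \<Rightarrow> real^2) \<Rightarrow> bool" where
  "symmetric_trilinear K \<longleftrightarrow>
     (\<forall>v w. linear (\<lambda>u. K u v w)) \<and>
     (\<forall>u w. linear (\<lambda>v. K u v w)) \<and>
     (\<forall>u v. linear (\<lambda>w. K u v w)) \<and>
     (\<forall>u v w. K u v w = K v u w \<and> K u v w = K u w v)"

text \<open>Here \<open>a\<close> is the unscaled parameter (alpha-check), and \<open>u t x y\<close> is the unknown
  in the frame moving with velocity \<open>\<beta> * c\<close>.  Solutions are classical.\<close>

definition solves_system ::
  "real \<Rightarrow> real \<Rightarrow> real^2^2 \<Rightarrow> real^2^2 \<Rightarrow>
   (real^2 \<Rightarrow> real^2 \<Rightarrow> real^2) \<Rightarrow> (real^2 \<Rightarrow> real^2 \<Rightarrow> real^2 \<Rightarrow> real^2) \<Rightarrow>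
   real \<Rightarrow> real \<Rightarrow> real \<Rightarrow> (real \<Rightarrow> real \<Rightarrow> real \<Rightarrow> real^2) \<Rightarrow> bool" where
  "solves_system d1 d2 L M Q K a \<beta> c u \<longleftrightarrow>
     (\<exists>ut ux uy uxx uyy. \<forall>t x y.
        ((\<lambda>s. u s x y) has_vector_derivative ut t x y) (at t) \<and>
        ((\<lambda>s. u t s y) has_vector_derivative ux t x y) (at x) \<and>
        ((\<lambda>s. u t x s) has_vector_derivative uy t x y) (at y) \<and>
        ((\<lambda>s. ux t s y) has_vector_derivative uxx t x y) (at x) \<and>
        ((\<lambda>s. uy t x s) has_vector_derivative uyy t x y) (at y) \<and>
        ut t x y =
          diag2 d1 d2 *v (uxx t x y + uyy t x y) + L *v u t x y + a *\<^sub>R (M *v u t x y)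
          + \<beta> *\<^sub>R (B_mat c *v ux t x y)
          + Q (u t x y) (u t x y) + K (u t x y) (u t x y) (u t x y))"

definition fourier_symbol ::
  "real \<Rightarrow> real \<Rightarrow> real^2^2 \<Rightarrow> real^2^2 \<Rightarrow> real \<Rightarrow> real \<Rightarrow> real \<Rightarrow> real \<Rightarrow> real \<Rightarrow> complex^2^2" where
  "fourier_symbol d1 d2 L M c a \<beta> k l =
     (\<chi> i j. - complex_of_real (k^2 + l^2) * complex_matrix (diag2 d1 d2) $ i $ j
            + complex_matrix L $ i $ j + complex_of_real a * complex_matrix M $ i $ j
            + \<i> * complex_of_real k * complex_of_real \<beta> * complex_matrix (B_mat c) $ i $ j)"

definition disp ::
  "real \<Rightarrow> real \<Rightarrow> real^2^2 \<Rightarrow> real^2^2 \<Rightarrow> real \<Rightarrow> real \<Rightarrow> real \<Rightarrow> complex \<Rightarrow> real \<Rightarrow> real \<Rightarrow> complex" where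
  "disp d1 d2 L M c a \<beta> z k l = det (fourier_symbol d1 d2 L M c a \<beta> k l - mat z)"

text \<open>At \<open>\<beta> = 0\<close> the symbol does not depend on \<open>c\<close>; below \<open>c\<close> is set to \<open>0\<close> there.\<close>

definition turing_instability ::
  "real \<Rightarrow> real \<Rightarrow> real^2^2 \<Rightarrow> real^2^2 \<Rightarrow> real \<Rightarrow> bool" where
  "turing_instability d1 d2 L M kc \<longleftrightarrow>
     0 < kc \<and>
     (\<forall>z. eigenvalue_of L z \<longrightarrow> Re z < 0) \<and>
     (\<forall>k l z. disp d1 d2 L M 0 0 0 z k l = 0 \<and> 0 \<le> Re z \<longleftrightarrow>
              z = 0 \<and> k^2 + l^2 = kc^2) \<and>
     (\<forall>k l. k^2 + l^2 = kc^2 \<longrightarrow> deriv (\<lambda>z. disp d1 d2 L M 0 0 0 z k l) 0 \<noteq> 0)"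

text \<open>The quotient is real, and depends on the critical wavevector only through its length,
  so it is evaluated at \<open>(kc, 0)\<close>.\<close>

definition lambda_M ::
  "real \<Rightarrow> real \<Rightarrow> real^2^2 \<Rightarrow> real^2^2 \<Rightarrow> real \<Rightarrow> real" where
  "lambda_M d1 d2 L M kc =
     Re (- vector_derivative (\<lambda>a. disp d1 d2 L M 0 a 0 0 kc 0) (at 0)
         / deriv (\<lambda>z. disp d1 d2 L M 0 0 0 z kc 0) 0)"

definition lambda_beta :: "real \<Rightarrow> real \<Rightarrow> real^2^2 \<Rightarrow> real \<Rightarrow> real" where
  "lambda_beta d1 d2 L kc =
     (L $ 2 $ 2 - kc^2 * d2) / (L $ 1 $ 1 + L $ 2 $ 2 - kc^2 * (d1 + d2))"

text \<open>\<open>\<phi>\<close> is the profile of a stripe with wavenumber \<open>\<kappa>\<close> and velocity \<open>\<beta> * c\<close>; its amplitude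
  \<open>A\<close> is measured in the supremum norm.\<close>

definition stripe ::
  "real \<Rightarrow> real \<Rightarrow> real^2^2 \<Rightarrow> real^2^2 \<Rightarrow>
   (real^2 \<Rightarrow> real^2 \<Rightarrow> real^2) \<Rightarrow> (real^2 \<Rightarrow> real^2 \<Rightarrow> real^2 \<Rightarrow> real^2) \<Rightarrow>
   real \<Rightarrow> real \<Rightarrow> real \<Rightarrow> real \<Rightarrow> real \<Rightarrow> (real \<Rightarrow> real^2) \<Rightarrow> bool" where
  "stripe d1 d2 L M Q K a \<beta> \<kappa> A c \<phi> \<longleftrightarrow>
     0 < \<kappa> \<and>
     solves_system d1 d2 L M Q K a \<beta> c (\<lambda>t x y. \<phi> x) \<and>
     (\<forall>x. \<phi> (x + 2 * pi / \<kappa>) = \<phi> x) \<and>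
     \<not> \<phi> constant_on UNIV \<and>
     0 < A \<and> A = (SUP x. norm (\<phi> x))"

end

theory Submission
  imports Defs
begin

text \<open>Stability of the homogeneous modes gives \<open>a1 + a4 < 0\<close> and \<open>det L > 0\<close>.  Write
  \<open>p = a1 - kc^2 d1\<close>, \<open>q = a4 - kc^2 d2\<close>.  Criticality at \<open>kc\<close> says \<open>p q = a2 a3\<close>, and expanding
  it forces \<open>a1 d2 + a4 d1 > 0\<close>; together with the negative trace, \<open>a1\<close> and \<open>a4\<close> have
  opposite signs, hence \<open>a2 a3 < 0\<close> and \<open>p q < 0\<close>.  Thus \<open>q\<close> has the sign opposite to \<open>a1\<close>,
  while the denominator \<open>p + q\<close> of \<open>\<lambda>\<^sub>\<beta>\<close> is negative, so \<open>\<lambda>\<^sub>\<beta>\<close> has the sign of \<open>a1\<close>.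
  Being nonzero, this sign is inherited by \<open>-c\<close> near the Turing point.\<close>

lemma disp_unperturbed:
  assumes "L = vector [vector [a1, a2], vector [a3, a4]]"
  shows "disp d1 d2 L M 0 0 0 z k l =
    (of_real (a1 - (k^2 + l^2) * d1) - z) * (of_real (a4 - (k^2 + l^2) * d2) - z)
      - of_real (a2 * a3)"
  unfolding disp_def fourier_symbol_def complex_matrix_def diag2_def assms
  by (simp add: det_2 mat_def algebra_simps)

text \<open>This is the contrapositive of the Hurwitz criterion for trace \<open>T\<close> and
  determinant \<open>D\<close>. Real roots: the larger one, \<open>(T + r) / 2\<close>, works, since
  \<open>D \<le> 0\<close> gives \<open>\<bar>T\<bar> \<le> r\<close>. Non-real roots: their real
  part is \<open>T / 2\<close>.\<close>

lemma quadratic_root_nonneg_Re: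
  fixes T D :: real
  assumes "0 \<le> T \<or> D \<le> 0"
  obtains z :: complex where "z^2 - of_real T * z + of_real D = 0" "0 \<le> Re z"
proof (cases "0 \<le> T^2 - 4 * D")
  case True
  define r where "r = sqrt (T^2 - 4 * D)"
  define x where "x = (T + r) / 2"
  have r2: "r^2 = T^2 - 4 * D" and r0: "0 \<le> r"
    using True by (simp_all add: r_def)
  have "\<bar>T\<bar> \<le> r" if "D \<le> 0"
    unfolding r_def using that by (intro real_le_rsqrt) simp
  then have "0 \<le> x"
    using assms r0 by (auto simp: x_def)
  moreover have "x^2 - T * x + D = 0"
    using r2 by (simp add: x_def power2_eq_square field_simps)
  then have "(of_real x)^2 - of_real T * of_real x + of_real D = (0::complex)"
    by (metis of_real_0 of_real_add of_real_diff of_real_mult of_real_power)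
  ultimately show thesis
    using that[of "of_real x"] by simp
next
  case False
  define r where "r = sqrt (4 * D - T^2)"
  have r2: "r^2 = 4 * D - T^2"
    using False by (simp add: r_def)
  \<comment> \<open>A negative discriminant rules out \<open>D \<le> 0\<close>, so the hypothesis
    leaves only \<open>0 \<le> T\<close>.\<close>
  have "0 < D"
    using False by (smt (verit) zero_le_power2)
  then have "0 \<le> T"
    using assms by simp
  moreover have "(Complex (T/2) (r/2))^2 - of_real T * Complex (T/2) (r/2) + of_real D = 0"
    using r2 by (simp add: complex_eq_iff power2_eq_square field_simps)
  ultimately show thesis
    using that[of "Complex (T/2) (r/2)"] by simp
qed

text \<open>The spectral condition is read at two wavevectors: \<open>(kc, 0)\<close> with
  \<open>z = 0\<close> gives criticality. At \<open>(0, 0)\<close>, off the critical circle because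
  \<open>kc > 0\<close>, no root has nonnegative real part, which fixes the signs of trace and
  determinant of \<open>L\<close>.\<close>

lemma turing_instability_conditions:
  assumes turing: "turing_instability d1 d2 L M kc"
    and L: "L = vector [vector [a1, a2], vector [a3, a4]]"
  shows "0 < kc" "a1 + a4 < 0" "0 < a1 * a4 - a2 * a3"
    "(a1 - kc^2 * d1) * (a4 - kc^2 * d2) = a2 * a3"
proof -
  show kc: "0 < kc"
    using turing by (simp add: turing_instability_def)
  have spec: "disp d1 d2 L M 0 0 0 z k l = 0 \<and> 0 \<le> Re z \<longleftrightarrow> z = 0 \<and> k^2 + l^2 = kc^2"
    for z k l
    using turing by (simp add: turing_instability_def)
  have "disp d1 d2 L M 0 0 0 0 kc 0 = 0"
    using spec[of 0 kc 0] by simp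
  then show "(a1 - kc^2 * d1) * (a4 - kc^2 * d2) = a2 * a3"
    unfolding disp_unperturbed[OF L]
    by (simp flip: of_real_mult of_real_diff)
  have "\<not> (0 \<le> a1 + a4 \<or> a1 * a4 - a2 * a3 \<le> 0)"
  proof
    assume "0 \<le> a1 + a4 \<or> a1 * a4 - a2 * a3 \<le> 0"
    then obtain z :: complex
      where z: "z^2 - of_real (a1 + a4) * z + of_real (a1 * a4 - a2 * a3) = 0" "0 \<le> Re z"
      by (rule quadratic_root_nonneg_Re)
    have "disp d1 d2 L M 0 0 0 z 0 0 = 0"
      using z(1) unfolding disp_unperturbed[OF L] by (simp add: algebra_simps power2_eq_square)
    then show False
      using spec[of z 0 0] z(2) kc by simp
  qed
  then show "a1 + a4 < 0" "0 < a1 * a4 - a2 * a3"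
    by auto
qed

lemma sgn_lambda_beta:
  assumes d: "0 < d1" "0 < d2"
    and L: "L = vector [vector [a1, a2], vector [a3, a4]]"
    and turing: "turing_instability d1 d2 L M kc"
  shows "sgn (lambda_beta d1 d2 L kc) = sgn a1" "a1 \<noteq> 0"
proof -
  note cond = turing_instability_conditions[OF turing L]
  define s where "s = kc^2"
  define p where "p = a1 - s * d1"
  define q where "q = a4 - s * d2"
  have s: "0 < s"
    using cond(1) by (simp add: s_def)
  have pq: "p * q = a2 * a3"
    using cond(4) by (simp add: s_def p_def q_def)
  have "s * (a1 * d2 + a4 * d1) = s^2 * (d1 * d2) + (a1 * a4 - a2 * a3)"
    using pq by (simp add: p_def q_def algebra_simps power2_eq_square)
  also have "\<dots> > 0"
    using cond(3) d s by (simp add: add_pos_pos)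
  finally have mixed: "0 < a1 * d2 + a4 * d1"
    using s by (simp add: zero_less_mult_iff)
  have sd: "0 < s * d1" "0 < s * d2"
    using s d by simp_all
  have denom: "p + q < 0"
    using cond(2) sd by (simp add: p_def q_def)
  have lam: "lambda_beta d1 d2 L kc = q / (p + q)"
    by (simp add: lambda_beta_def L p_def q_def s_def algebra_simps)
  \<comment> \<open>If both were nonpositive, \<open>mixed\<close> would fail; if both were
    nonnegative, the trace could not be negative. So neither entry vanishes.\<close>
  consider "0 < a1" "a4 < 0" | "a1 < 0" "0 < a4"
    using mixed cond(2) d
    by (smt (verit) mult_nonneg_nonneg mult_nonpos_nonneg)
  then have "sgn (lambda_beta d1 d2 L kc) = sgn a1 \<and> a1 \<noteq> 0"
  proof cases
    case 1
    then have "q < 0"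
      using sd by (simp add: q_def)
    then show ?thesis
      using 1 denom by (simp add: lam sgn_divide)
  next
    case 2
    \<comment> \<open>Here \<open>q\<close> is a difference of positive terms, so its sign is found
      indirectly, from those of \<open>p\<close> and \<open>p * q\<close>.\<close>
    then have "p < 0"
      using sd by (simp add: p_def)
    moreover have "p * q < 0"
      using pq cond(3) 2 by (smt (verit) mult_neg_pos)
    ultimately have "0 < q"
      by (simp add: mult_less_0_iff)
    then show ?thesis
      using 2 denom by (simp add: lam sgn_divide)
  qed
  then show "sgn (lambda_beta d1 d2 L kc) = sgn a1" "a1 \<noteq> 0"
    by auto
qed

lemma tendsto_sgn_eq:
  fixes f :: "'a \<Rightarrow> real"
  assumes "(f \<longlongrightarrow> l) F" "l \<noteq> 0"
  shows "\<forall>\<^sub>F x in F. sgn (f x) = sgn l"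
proof (cases "0 < l")
  case True
  then show ?thesis
    using order_tendstoD(1)[OF assms(1) True] by (auto elim: eventually_mono)
next
  case False
  then have "l < 0"
    using assms(2) by simp
  then show ?thesis
    using order_tendstoD(2)[OF assms(1) \<open>l < 0\<close>] by (auto elim: eventually_mono)
qed

theorem mainTheorem4:
  fixes d1 d2 a1 a2 a3 a4 kc :: real
    and L M :: "real^2^2"
    and Q :: "real^2 \<Rightarrow> real^2 \<Rightarrow> real^2"
    and K :: "real^2 \<Rightarrow> real^2 \<Rightarrow> real^2 \<Rightarrow> real^2"
    and P :: "((real \<times> real \<times> real) \<times> real) set"
    and c :: "(real \<times> real \<times> real) \<times> real \<Rightarrow> real"
    and \<phi> :: "(real \<times> real \<times> real) \<times> real \<Rightarrow> real \<Rightarrow> real^2"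
  assumes "0 < d1" and "0 < d2"
    and "L = vector [vector [a1, a2], vector [a3, a4]]"
    and "symmetric_bilinear Q" and "symmetric_trilinear K"
    and "turing_instability d1 d2 L M kc"
    and "lambda_M d1 d2 L M kc \<noteq> 0"
    \<comment> \<open>a family of stripes, indexed by a set \<open>P\<close> of pairs \<open>(\<mu>, A)\<close> with \<open>\<mu> = (\<alpha>, \<beta>, \<kappa>')\<close>\<close>
    and "\<And>\<alpha> \<beta> \<kappa>' A. ((\<alpha>, \<beta>, \<kappa>'), A) \<in> P \<Longrightarrow>
           stripe d1 d2 L M Q K (\<alpha> / lambda_M d1 d2 L M kc) \<beta> (kc + \<kappa>') A
             (c ((\<alpha>, \<beta>, \<kappa>'), A)) (\<phi> ((\<alpha>, \<beta>, \<kappa>'), A))"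
    and "(c \<longlongrightarrow> - lambda_beta d1 d2 L kc) (at 0 within P)"
  shows "\<exists>\<epsilon>>0. \<forall>\<alpha> \<beta> \<kappa>' A.
           ((\<alpha>, \<beta>, \<kappa>'), A) \<in> P \<and> norm (\<alpha>, \<beta>, \<kappa>') < \<epsilon> \<and> A < \<epsilon> \<longrightarrow>
             sgn (c ((\<alpha>, \<beta>, \<kappa>'), A)) = - sgn (lambda_beta d1 d2 L kc) \<and>
             sgn (c ((\<alpha>, \<beta>, \<kappa>'), A)) = - sgn a1 \<and>
             (a1 < 0 \<longrightarrow> sgn (\<beta> * c ((\<alpha>, \<beta>, \<kappa>'), A)) = sgn \<beta>) \<and>
             (\<not> a1 < 0 \<longrightarrow> sgn (\<beta> * c ((\<alpha>, \<beta>, \<kappa>'), A)) = - sgn \<beta>)"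
proof -
  let ?lb = "lambda_beta d1 d2 L kc"
  note sgn_lb = sgn_lambda_beta[OF assms(1-3,6)]
  then have "?lb \<noteq> 0"
    by (metis sgn_0_0)
  then have "\<forall>\<^sub>F x in at 0 within P. sgn (c x) = sgn (- ?lb)"
    by (intro tendsto_sgn_eq[OF assms(9)]) simp
  then obtain \<delta> where "0 < \<delta>"
    and \<delta>: "\<And>x. x \<in> P \<Longrightarrow> x \<noteq> 0 \<Longrightarrow> dist x 0 < \<delta> \<Longrightarrow> sgn (c x) = - sgn ?lb"
    unfolding eventually_at by (auto simp: sgn_minus)
  show ?thesis
  \<comment> \<open>Half of \<open>\<delta>\<close> goes to \<open>\<mu>\<close> and half to
    \<open>A\<close>, because the norm of the pair is at most the sum of the norms.\<close>
  proof (intro exI[of _ "\<delta> / 2"] conjI allI impI)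
    show "0 < \<delta> / 2"
      using \<open>0 < \<delta>\<close> by simp
  next
    fix \<alpha> \<beta> \<kappa>' A
    assume *: "((\<alpha>, \<beta>, \<kappa>'), A) \<in> P \<and> norm (\<alpha>, \<beta>, \<kappa>') < \<delta> / 2 \<and> A < \<delta> / 2"
    then have "0 < A"
      using assms(8) by (auto simp: stripe_def)
    moreover have "norm ((\<alpha>, \<beta>, \<kappa>'), A) \<le> norm (\<alpha>, \<beta>, \<kappa>') + norm A"
      by (rule norm_Pair_le)
    ultimately have "dist ((\<alpha>, \<beta>, \<kappa>'), A) 0 < \<delta>"
      using * by (simp add: dist_norm)
    \<comment> \<open>The filter \<open>at 0 within P\<close> omits the origin; positive amplitude
      keeps every stripe away from it, even at \<open>\<mu> = 0\<close>.\<close>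
    moreover have "((\<alpha>, \<beta>, \<kappa>'), A) \<noteq> 0"
      using \<open>0 < A\<close> by (simp add: zero_prod_def)
    ultimately show c: "sgn (c ((\<alpha>, \<beta>, \<kappa>'), A)) = - sgn ?lb"
      using \<delta> * by blast
    show "sgn (c ((\<alpha>, \<beta>, \<kappa>'), A)) = - sgn a1"
      using c sgn_lb(1) by simp
    then show "sgn (\<beta> * c ((\<alpha>, \<beta>, \<kappa>'), A)) = sgn \<beta>" if "a1 < 0"
      using that by (simp add: sgn_mult)
    \<comment> \<open>Since \<open>a1 \<noteq> 0\<close>, this case means
      \<open>0 < a1\<close>.\<close>
    show "sgn (\<beta> * c ((\<alpha>, \<beta>, \<kappa>'), A)) = - sgn \<beta>" if "\<not> a1 < 0"
      using that sgn_lb c by (simp add: sgn_mult)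
  qed
qed

end
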